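(* For every integer $k\ge 1$ and every integer $n$ with $2^{k-1}+1\le n\le 2^{k-1}+2^{\lfloor k/2\rfloor}$, there exists a simple series-parallel broadcast graph on $n$ vertices.
   Context: A multigraph is series-parallel (SP) if it can be obtained from $K_2$ by a finite sequence of series extensions (replace an edge $\{x,y\}$ by a new vertex $z$ and edges $\{x,z\},\{z,y\}$) and parallel extensions (add an edge parallel to an existing edge); a simple graph is SP if it is the result of such a sequence with no multiple edges at the end. Broadcasting: initially only an originator holds a message; in each discrete time unit, every informed vertex may inform at most one uninformed neighbor. $b(v,G)$ is the minimum number of time units to inform all vertices from originator $v$, $b(G)=\max_v b(v,G)$, and a connected graph $G$ on $n$ vertices is a broadcast graph if $b(G)=\lceil\log_2 n\rceil$. *)

theory Defs
  imports Complex_Main "HOL-Library.Multiset"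
begin

text \<open>
  A multigraph is a vertex set together with a multiset of edges, each edge being an unordered
  pair \<open>{x, y}\<close>. Starting from \<open>K\<^sub>2\<close>, the extensions never create loops (see
  \<open>sp_multigraph_edge\<close> below), so in the series rule \<open>x\<close> and \<open>y\<close> are
  always distinct.
\<close>

inductive sp_multigraph :: "'a set \<Rightarrow> 'a set multiset \<Rightarrow> bool" where
  K2: "x \<noteq> y \<Longrightarrow> sp_multigraph {x, y} {#{x, y}#}"
| series: "sp_multigraph V M \<Longrightarrow> {x, y} \<in># M \<Longrightarrow> z \<notin> V \<Longrightarrow>
    sp_multigraph (insert z V) (M - {#{x, y}#} + {#{x, z}, {z, y}#})"
| parallel: "sp_multigraph V M \<Longrightarrow> e \<in># M \<Longrightarrow> sp_multigraph V (add_mset e M)"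

lemma sp_multigraph_edge:
  "sp_multigraph V M \<Longrightarrow> e \<in># M \<Longrightarrow> e \<subseteq> V \<and> card e = 2"
proof (induction arbitrary: e rule: sp_multigraph.induct)
  case (K2 x y)
  then show ?case by auto
next
  case (series V M x y z)
  have "x \<in> V" "y \<in> V" using series.IH[OF series.hyps(2)] by auto
  then have "x \<noteq> z" "y \<noteq> z" using series.hyps(3) by auto
  moreover have "e \<in># M \<or> e = {x, z} \<or> e = {z, y}"
    using series.prems by (auto dest: in_diffD)
  ultimately show ?case
    using series.IH \<open>x \<in> V\<close> \<open>y \<in> V\<close> by auto
next
  case (parallel V M e')
  then show ?case by auto
qed

definition simple_graph :: "'a set \<Rightarrow> 'a set set \<Rightarrow> bool" where
  "simple_graph V E \<longleftrightarrow> finite V \<and> (\<forall>e\<in>E. e \<subseteq> V \<and> card e = 2)"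

text \<open>The multigraph of \<open>mset_set E\<close> has every edge with multiplicity one.\<close>

definition sp_graph :: "'a set \<Rightarrow> 'a set set \<Rightarrow> bool" where
  "sp_graph V E \<longleftrightarrow> simple_graph V E \<and> sp_multigraph V (mset_set E)"

definition connected_graph :: "'a set \<Rightarrow> 'a set set \<Rightarrow> bool" where
  "connected_graph V E \<longleftrightarrow>
     V \<noteq> {} \<and> (\<forall>u\<in>V. \<forall>v\<in>V. (u, v) \<in> {(x, y). {x, y} \<in> E}\<^sup>*)"

text \<open>
  One time unit turns the set \<open>I\<close> of informed vertices into \<open>I'\<close>. The partial map
  \<open>c\<close> lists the calls made: an informed \<open>u\<close> informs \<open>w\<close> if
  \<open>c u = Some w\<close>, and stays idle if \<open>c u = None\<close>.
\<close>

definition broadcast_step :: "'a set \<Rightarrow> 'a set set \<Rightarrow> 'a set \<Rightarrow> 'a set \<Rightarrow> bool" where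
  "broadcast_step V E I I' \<longleftrightarrow>
     (\<exists>c. dom c \<subseteq> I \<and> (\<forall>u w. c u = Some w \<longrightarrow> w \<in> V - I \<and> {u, w} \<in> E)
        \<and> I' = I \<union> ran c)"

text \<open>
  The least number below is meaningful only if every vertex can be reached from \<open>v\<close>; it
  is used for connected graphs only.
\<close>

definition broadcast_time_from :: "'a set \<Rightarrow> 'a set set \<Rightarrow> 'a \<Rightarrow> nat" where
  "broadcast_time_from V E v = (LEAST t. (broadcast_step V E ^^ t) {v} V)"

definition broadcast_time :: "'a set \<Rightarrow> 'a set set \<Rightarrow> nat" where
  "broadcast_time V E = Max (broadcast_time_from V E ` V)"

definition broadcast_graph :: "'a set \<Rightarrow> 'a set set \<Rightarrow> bool" where
  "broadcast_graph V E \<longleftrightarrow> simple_graph V E \<and> connected_graph V E \<and>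
     int (broadcast_time V E) = \<lceil>log 2 (real (card V))\<rceil>"

end

theory Submission
  imports Defs
begin

text \<open>
  Let \<open>M = 2\<^sup>k\<^sup>-\<^sup>1\<close> and \<open>m = \<lfloor>k/2\<rfloor>\<close>. Take the binomial tree on
  \<open>{0..<M}\<close>, where the parent of a vertex is obtained by clearing its lowest set bit, hang
  a subtree of a second binomial tree of order \<open>m\<close> (vertices \<open>M + 1, \<dots>, n - 1\<close>) at its root
  \<open>0\<close>, and join a hub \<open>M\<close> to all vertices of the resulting tree. Adding a leaf to the tree is a
  parallel extension followed by a series extension, so the graph is series-parallel.

  An originator \<open>v\<close> first calls the hub. Then \<open>v\<close> informs the copy of the binomial tree of
  order \<open>m\<close> containing it, which takes at most \<open>2m - 1 \<le> k - 1\<close> steps from any of its vertices.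
  A binomial tree of order \<open>q\<close> without such a copy splits into binomial trees of
  orders \<open>q - 1, \<dots>, m\<close>, so the hub can inform all other vertices in the same time by calling
  the roots of the pieces in decreasing order. The vertices \<open>M + 1, \<dots>, n - 1\<close> span a subtree
  of a binomial tree of order \<open>m\<close> with root \<open>0\<close> and also one with root \<open>M\<close>: the first serves
  originators among them, and with the second the hub informs them if \<open>v \<le> M\<close>. The hub
  as originator first calls \<open>0\<close>, which leads to the same situation as \<open>v = 0\<close>.
\<close>

section \<open>Broadcast schemes\<close>

text \<open>\<open>covers E t u S\<close>: within \<open>S\<close>, the vertex \<open>u\<close> can inform all of \<open>S\<close> in time \<open>t\<close>; the
  recursion splits \<open>S\<close> at the first call of \<open>u\<close>.\<close>

fun covers :: "'a set set \<Rightarrow> nat \<Rightarrow> 'a \<Rightarrow> 'a set \<Rightarrow> bool" where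
  "covers E 0 u S \<longleftrightarrow> S = {u}"
| "covers E (Suc t) u S \<longleftrightarrow> covers E t u S \<or>
     (\<exists>w A B. {u, w} \<in> E \<and> A \<inter> B = {} \<and> S = A \<union> B \<and> covers E t u A \<and> covers E t w B)"

lemma covers_call:
  assumes "{u, w} \<in> E" "covers E t u A" "covers E t w B" "A \<inter> B = {}" "S = A \<union> B"
  shows "covers E (Suc t) u S"
  using assms by auto

lemma covers_mono: "covers E t u S \<Longrightarrow> t \<le> t' \<Longrightarrow> covers E t' u S"
  by (induction t' rule: nat_induct) (auto simp: le_Suc_eq)

lemma covers_origin: "covers E t u S \<Longrightarrow> u \<in> S"
  by (induction t arbitrary: u S) auto

text \<open>Carries schemes for binomial trees over to the hub graph: along the identity, the shift
  by \<open>M\<close>, and the shift by \<open>M\<close> that fixes 0.\<close>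

lemma covers_image:
  assumes "covers E t u S" "inj_on f S"
    and "\<And>a b. a \<in> S \<Longrightarrow> b \<in> S \<Longrightarrow> {a, b} \<in> E \<Longrightarrow> {f a, f b} \<in> E'"
  shows "covers E' t (f u) (f ` S)"
  using assms
proof (induction t arbitrary: u S)
  case 0
  then show ?case by auto
next
  case (Suc t)
  from Suc.prems(1) consider "covers E t u S"
    | w A B where "{u, w} \<in> E" "A \<inter> B = {}" "S = A \<union> B" "covers E t u A" "covers E t w B"
    by auto
  then show ?case
  proof cases
    case 1
    then have "covers E' t (f u) (f ` S)" by (rule Suc.IH) (use Suc.prems in auto)
    then show ?thesis by simp
  next
    case 2
    have "inj_on f A" "inj_on f B" using 2 Suc.prems(2) by (auto simp: inj_on_Un)
    have fA: "covers E' t (f u) (f ` A)"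
      using 2(4) \<open>inj_on f A\<close> by (rule Suc.IH) (use 2 Suc.prems(3) in auto)
    have fB: "covers E' t (f w) (f ` B)"
      using 2(5) \<open>inj_on f B\<close> by (rule Suc.IH) (use 2 Suc.prems(3) in auto)
    have fe: "{f u, f w} \<in> E'"
      using 2 Suc.prems(3) covers_origin[OF 2(4)] covers_origin[OF 2(5)] by auto
    have "f ` A \<inter> f ` B = {}"
      using inj_on_image_Int[OF Suc.prems(2), of A B] 2 by auto
    then show ?thesis
      by (rule covers_call[OF fe fA fB]) (auto simp: 2)
  qed
qed

text \<open>Each informed vertex works only inside its own territory \<open>S u\<close>. Territories
  are disjoint, so simultaneous calls never collide, and a call hands part of the caller's territory
  to the vertex called.\<close>

lemma relpow_broadcast_step_covers:
  assumes "\<And>u. u \<in> I \<Longrightarrow> covers E t u (S u)"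
    and "\<And>u w. u \<in> I \<Longrightarrow> w \<in> I \<Longrightarrow> u \<noteq> w \<Longrightarrow> S u \<inter> S w = {}"
    and "(\<Union>u\<in>I. S u) = V"
  shows "(broadcast_step V E ^^ t) I V"
  using assms
proof (induction t arbitrary: I S)
  case 0
  then show ?case by auto
next
  case (Suc t)
  define Q where "Q u w A B \<longleftrightarrow> {u, w} \<in> E \<and> A \<inter> B = {} \<and> S u = A \<union> B \<and>
    covers E t u A \<and> covers E t w B" for u w A B
  \<comment> \<open>Vertices of \<open>I\<close> outside \<open>J\<close> stay idle: the remaining
    \<open>t\<close> steps suffice for them.\<close>
  define J where "J = {u \<in> I. \<not> covers E t u (S u)}"
  have "\<exists>w A B. Q u w A B" if "u \<in> J" for u
    using Suc.prems(1)[of u] that unfolding Q_def J_def by auto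
  then obtain w A B where wAB: "\<And>u. u \<in> J \<Longrightarrow> Q u (w u) (A u) (B u)" by metis
  define c where "c u = (if u \<in> J then Some (w u) else None)" for u
  have wB: "w u \<in> B u" and uA: "u \<in> A u" and BS: "B u \<subseteq> S u" and AS: "A u \<subseteq> S u"
    and dAB: "A u \<inter> B u = {}" and SAB: "S u = A u \<union> B u" if "u \<in> J" for u
    using wAB[OF that] covers_origin unfolding Q_def by fast+
  have JI: "J \<subseteq> I" by (auto simp: J_def)
  have uS: "u \<in> S u" if "u \<in> I" for u using Suc.prems(1)[OF that] by (rule covers_origin)
  have wI: "w u \<notin> I" if "u \<in> J" for u
  proof
    assume "w u \<in> I"
    then have "w u \<in> S u \<inter> S (w u)" using uS wB[OF that] BS[OF that] by auto
    moreover have "u \<in> I" using that JI by auto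
    ultimately have "w u = u" using Suc.prems(2)[of u "w u"] \<open>w u \<in> I\<close> by fastforce
    then show False using wB[OF that] uA[OF that] dAB[OF that] by auto
  qed
  have ran: "ran c = w ` J" by (auto simp: ran_def c_def)
  have "broadcast_step V E I (I \<union> ran c)"
    unfolding broadcast_step_def
  proof (intro exI conjI allI impI)
    show "dom c \<subseteq> I" using JI by (auto simp: c_def dom_def split: if_splits)
    fix u x assume "c u = Some x"
    then have u: "u \<in> J" "x = w u" by (auto simp: c_def split: if_splits)
    have "x \<in> S u" using wB[OF u(1)] BS[OF u(1)] u(2) by auto
    then show "x \<in> V - I" using wI[OF u(1)] u JI Suc.prems(3) by auto
    show "{u, x} \<in> E" using wAB u by (auto simp: Q_def)
  qed simp
  moreover have "(broadcast_step V E ^^ t) (I \<union> ran c) V"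
  proof -
    have wd: "w u \<noteq> w v" if "u \<in> J" "v \<in> J" "u \<noteq> v" for u v
    proof -
      have "S u \<inter> S v = {}" using Suc.prems(2)[of u v] that JI by auto
      moreover have "w u \<in> S u" "w v \<in> S v" using wB BS that by auto
      ultimately show ?thesis by auto
    qed
    then have inj: "inj_on w J" by (auto simp: inj_on_def)
    \<comment> \<open>A newly informed vertex takes over the part \<open>B\<close> of its caller,
      which \<open>inv_into J w\<close> recovers.\<close>
    define S' where "S' x = (if x \<in> J then A x else if x \<in> I then S x else B (inv_into J w x))" for x
    have S'w: "S' (w u) = B u" if "u \<in> J" for u
      using that wI[OF that] JI by (auto simp: S'_def inv_into_f_f[OF inj])
    have S'J: "S' u = A u" if "u \<in> J" for u
      using that by (auto simp: S'_def)
    have S'I: "S' u = S u" if "u \<in> I - J" for u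
      using that by (auto simp: S'_def)
    have split: "I \<union> ran c = J \<union> (I - J) \<union> w ` J" using JI ran by auto
    have S'sub: "\<exists>v\<in>I. S' x \<subseteq> S v \<and> (x = v \<or> v \<in> J \<and> x = w v)" if "x \<in> I \<union> ran c" for x
    proof -
      consider "x \<in> J" | "x \<in> I - J" | v where "v \<in> J" "x = w v" using \<open>x \<in> I \<union> ran c\<close> unfolding split by auto
      then show ?thesis
      proof cases
        case 1
        then show ?thesis using S'J[of x] AS[of x] JI by auto
      next
        case 2
        then show ?thesis using S'I[of x] by auto
      next
        case 3
        then show ?thesis using S'w[of v] BS[of v] JI by auto
      qed
    qed
    show ?thesis
    proof (rule Suc.IH)
      fix u assume "u \<in> I \<union> ran c"
      then show "covers E t u (S' u)"
        unfolding split
      proof (elim UnE imageE)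
        assume "u \<in> J"
        then show ?thesis using wAB[of u] S'J[of u] by (simp add: Q_def)
      next
        assume "u \<in> I - J"
        then show ?thesis using S'I[of u] by (simp add: J_def)
      next
        fix v assume "u = w v" "v \<in> J"
        then show ?thesis using wAB[of v] S'w[of v] by (simp add: Q_def)
      qed
    next
      fix x y assume xy: "x \<in> I \<union> ran c" "y \<in> I \<union> ran c" "x \<noteq> y"
      obtain u where u: "u \<in> I" "S' x \<subseteq> S u" "x = u \<or> u \<in> J \<and> x = w u"
        using S'sub[OF xy(1)] by blast
      obtain v where v: "v \<in> I" "S' y \<subseteq> S v" "y = v \<or> v \<in> J \<and> y = w v"
        using S'sub[OF xy(2)] by blast
      show "S' x \<inter> S' y = {}"
      proof (cases "u = v")
        case False
        then show ?thesis using Suc.prems(2)[OF u(1) v(1) False] u(2) v(2) by auto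
      next
        case True
        then have "u \<in> J" "x = u \<and> y = w u \<or> x = w u \<and> y = u" using u(3) v(3) xy(3) by auto
        then show ?thesis using S'w[of u] S'J[of u] dAB[of u] by auto
      qed
    next
      have "(\<Union>x\<in>I \<union> ran c. S' x) = (\<Union>u\<in>J. A u) \<union> (\<Union>u\<in>I - J. S u) \<union> (\<Union>u\<in>J. B u)"
        unfolding split UN_Un using S'w S'J S'I by simp
      also have "\<dots> = (\<Union>u\<in>J. S u) \<union> (\<Union>u\<in>I - J. S u)" using SAB by auto
      also have "\<dots> = V" using Suc.prems(3) JI by blast
      finally show "(\<Union>x\<in>I \<union> ran c. S' x) = V" .
    qed
  qed
  ultimately show ?case by (rule relpowp_Suc_I2)
qed

text \<open>One call per informed vertex at most doubles the informed set; this gives the lower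
  bound on broadcast times.\<close>

lemma relpow_broadcast_step_card:
  assumes "(broadcast_step V E ^^ t) I I'" "finite I"
  shows "finite I' \<and> card I' \<le> 2 ^ t * card I"
  using assms(1)
proof (induction t arbitrary: I')
  case 0
  then show ?case using assms(2) by auto
next
  case (Suc t)
  then obtain K where K: "(broadcast_step V E ^^ t) I K" "broadcast_step V E K I'" by auto
  obtain c where c: "dom c \<subseteq> K" "I' = K \<union> ran c"
    using K(2) unfolding broadcast_step_def by auto
  have fK: "finite K" "card K \<le> 2 ^ t * card I" using Suc.IH[OF K(1)] by auto
  have ran: "ran c \<subseteq> (\<lambda>u. the (c u)) ` K"
    using c(1) by (force simp: ran_def)
  have "card (ran c) \<le> card K"
    by (rule order_trans[OF card_mono[OF _ ran] card_image_le]) (use fK in auto)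
  then have "card I' \<le> 2 * card K" using c(2) card_Un_le[of K "ran c"] by auto
  moreover have "finite I'" using c(2) ran fK finite_subset by auto
  ultimately show ?case using fK(2) by auto
qed

section \<open>Binomial trees\<close>

text \<open>Every \<open>i > 0\<close> is adjacent to the number obtained by clearing its lowest set bit, so the
  interval \<open>{c..<c + 2 ^ q}\<close> with \<open>2 ^ q dvd c\<close> spans a binomial tree of order \<open>q\<close> with root
  \<open>c\<close>, and \<open>{c..<c + l}\<close> is a subtree containing the root.\<close>

definition binomial_edges :: "nat set set" where
  "binomial_edges = {{a, a + 2 ^ j} | a j. 2 ^ Suc j dvd a}"

lemma singleton_notin_binomial_edges: "{a} \<notin> binomial_edges"
proof
  assume "{a} \<in> binomial_edges"
  then obtain x j where "{a} = {x, x + (2::nat) ^ j}" unfolding binomial_edges_def by blast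
  then have "x + 2 ^ j = x" by (metis insertI1 insert_commute singletonD)
  then show False by simp
qed

lemma binomial_halves_edge:
  assumes "2 ^ Suc q dvd (c :: nat)"
  shows "{c, c + 2 ^ q} \<in> binomial_edges" "{c + 2 ^ q, c} \<in> binomial_edges"
    and "2 ^ q dvd c" "2 ^ q dvd c + 2 ^ q"
proof -
  show "{c, c + 2 ^ q} \<in> binomial_edges" using assms unfolding binomial_edges_def by blast
  then show "{c + 2 ^ q, c} \<in> binomial_edges" by (simp add: insert_commute)
  show "2 ^ q dvd c" using assms by (meson dvd_trans le_imp_power_dvd lessI less_imp_le)
  then show "2 ^ q dvd c + 2 ^ q" by auto
qed

lemma disjoint_of_insert_Int:
  assumes "insert d Z \<inter> Y = {d}" "d \<notin> Z"
  shows "Z \<inter> Y = {}"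
proof (rule equals0I)
  fix x assume "x \<in> Z \<inter> Y"
  then have "x \<in> insert d Z \<inter> Y" by auto
  then have "x = d" unfolding assms(1) by simp
  then show False using \<open>x \<in> Z \<inter> Y\<close> assms(2) by auto
qed

lemma covers_binomial_root:
  assumes "2 ^ q dvd c" "0 < l" "l \<le> 2 ^ q"
  shows "covers binomial_edges q c {c..<c + l}"
  using assms
proof (induction q arbitrary: c l)
  case 0
  then have "l = 1" by simp
  then show ?case by auto
next
  case (Suc q)
  note halves = binomial_halves_edge[OF Suc.prems(1)]
  show ?case
  proof (cases "l \<le> 2 ^ q")
    case True
    then show ?thesis using Suc.IH[of c l] Suc.prems halves(3) by auto
  next
    case False
    have "covers binomial_edges q c {c..<c + 2 ^ q}" using Suc.IH[of c "2 ^ q"] halves(3) by simp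
    moreover have "covers binomial_edges q (c + 2 ^ q) {c + 2 ^ q..<c + 2 ^ q + (l - 2 ^ q)}"
      using Suc.IH[of "c + 2 ^ q" "l - 2 ^ q"] halves(4) Suc.prems False by simp
    ultimately show ?thesis
      by (rule covers_call[OF halves(1)]) (use False in auto)
  qed
qed

text \<open>The last hypothesis says that \<open>c\<close> can serve \<open>X\<close> with delay \<open>t\<close> before turning to any
  territory \<open>Y\<close> that takes \<open>q\<close> steps. Moving from a tree to the half containing \<open>v\<close>
  shifts the other half into \<open>X\<close>.\<close>

lemma covers_binomial_delay:
  assumes "2 ^ q dvd c" "c \<le> v" "v < c + l" "l \<le> 2 ^ q" "X \<inter> {c..<c + l} = {c}"
    and "\<And>Y. covers binomial_edges q c Y \<Longrightarrow> X \<inter> Y = {c} \<Longrightarrow>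
           covers binomial_edges (q + t) c (X \<union> Y)"
  shows "covers binomial_edges (2 * q + t) v (X \<union> {c..<c + l})"
  using assms
proof (induction q arbitrary: c l X t)
  case 0
  then have "l = 1" "v = c" by simp_all
  then show ?case using 0 by auto
next
  case (Suc q)
  let ?C = "covers binomial_edges"
  note halves = binomial_halves_edge[OF Suc.prems(1)]
  show ?case
  proof (cases "l \<le> 2 ^ q")
    case True
    have "?C (2 * q + Suc t) v (X \<union> {c..<c + l})"
    proof (rule Suc.IH)
      fix Y assume "?C q c Y" "X \<inter> Y = {c}"
      then show "?C (q + Suc t) c (X \<union> Y)" using Suc.prems(6)[of Y] by simp
    qed (use True halves Suc.prems in auto)
    then show ?thesis by (rule covers_mono) simp
  next
    case False
    define d where "d = c + 2 ^ q"
    define A where "A = {c..<d}"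
    define B where "B = {d..<c + l}"
    have AB: "{c..<c + l} = A \<union> B" "A \<inter> B = {}" "c \<in> A" "d \<in> B"
      using False by (auto simp: A_def B_def d_def)
    have B': "B = {d..<d + (l - 2 ^ q)}" using False by (auto simp: B_def d_def)
    have cA: "?C q c A"
      unfolding A_def d_def by (rule covers_binomial_root) (use halves in auto)
    have cB: "?C q d B"
      unfolding B' by (rule covers_binomial_root) (use halves False Suc.prems in \<open>auto simp: d_def\<close>)
    have X: "X \<inter> A = {c}" "X \<inter> B = {}" using Suc.prems(5) AB by auto
    show ?thesis
    proof (cases "v < d")
      case True
      \<comment> \<open>Serving \<open>B\<close> costs \<open>c\<close> one call to \<open>d\<close>
        before turning to \<open>Y\<close>, so the delay grows by one.\<close>
      have "?C (2 * q + Suc t) v ((X \<union> B) \<union> {c..<c + 2 ^ q})"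
      proof (rule Suc.IH)
        fix Y assume Y: "?C q c Y" "(X \<union> B) \<inter> Y = {c}"
        have "?C (Suc q) c (Y \<union> B)"
          by (rule covers_call[OF _ Y(1) cB]) (use halves Y AB in \<open>auto simp: d_def\<close>)
        then have "?C (Suc q + t) c (X \<union> (Y \<union> B))"
          by (rule Suc.prems(6)) (use X Y AB in blast)
        then show "?C (q + Suc t) c ((X \<union> B) \<union> Y)" by (simp add: ac_simps)
      qed (use True halves Suc.prems X AB in \<open>auto simp: A_def d_def\<close>)
      then have "?C (2 * q + Suc t) v (X \<union> {c..<c + l})"
        using AB(1) by (simp add: A_def d_def Un_ac)
      then show ?thesis by (rule covers_mono) simp
    next
      case False
      \<comment> \<open>Now \<open>d\<close> first calls \<open>c\<close>, which needs
        \<open>Suc q + t\<close> steps for \<open>X \<union> A\<close>. Relative to order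
        \<open>q\<close> the delay grows by two, which accounts for the factor 2 in the
        bound.\<close>
      have "?C (2 * q + Suc (Suc t)) v (insert d (X \<union> A) \<union> {d..<d + (l - 2 ^ q)})"
      proof (rule Suc.IH)
        fix Y assume Y: "?C q d Y" "insert d (X \<union> A) \<inter> Y = {d}"
        have cXA: "?C (Suc q + t) c (X \<union> A)"
          by (rule Suc.prems(6)) (use X cA in auto)
        have dY: "?C (Suc q + t) d Y" using Y(1) by (rule covers_mono) simp
        have dc: "{d, c} \<in> binomial_edges" using halves by (simp add: d_def)
        have "d \<notin> X \<union> A" using X AB by blast
        then have "Y \<inter> (X \<union> A) = {}" using disjoint_of_insert_Int[OF Y(2)] by auto
        then have "?C (Suc (Suc q + t)) d (Y \<union> (X \<union> A))"
          by (rule covers_call[OF dc dY cXA]) simp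
        moreover have "insert d (X \<union> A) \<union> Y = Y \<union> (X \<union> A)" using Y by blast
        ultimately show "?C (q + Suc (Suc t)) d (insert d (X \<union> A) \<union> Y)" by simp
      next
        show "insert d (X \<union> A) \<inter> {d..<d + (l - 2 ^ q)} = {d}"
          unfolding B'[symmetric] using X AB by blast
      qed (use False halves Suc.prems \<open>\<not> l \<le> 2 ^ q\<close> in \<open>auto simp: d_def\<close>)
      moreover have "insert d (X \<union> A) \<union> {d..<d + (l - 2 ^ q)} = X \<union> {c..<c + l}"
        unfolding B'[symmetric] using AB by blast
      ultimately show ?thesis by simp
    qed
  qed
qed

text \<open>The delay lemma at order \<open>q\<close> alone would give \<open>2 * q\<close>.
  Splitting by hand at the top saves a step: nothing outside the tree is to be served, so the root
  of either half serves the other with delay one, and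
  \<open>2 * (q - 1) + 1 = 2 * q - 1\<close>.\<close>

lemma covers_binomial:
  assumes "2 ^ q dvd c" "c \<le> v" "v < c + l" "l \<le> 2 ^ q"
  shows "covers binomial_edges (2 * q - 1) v {c..<c + l}"
proof (cases q)
  case 0
  then have "l = 1" "v = c" using assms by simp_all
  then show ?thesis using 0 by auto
next
  case (Suc p)
  let ?C = "covers binomial_edges"
  note halves = binomial_halves_edge[OF assms(1)[unfolded Suc]]
  show ?thesis
  proof (cases "l \<le> 2 ^ p")
    case True
    have "?C (2 * p + 0) v ({c} \<union> {c..<c + l})"
    proof (rule covers_binomial_delay)
      fix Y assume Y: "?C p c Y" "{c} \<inter> Y = {c}"
      then have "{c} \<union> Y = Y" by auto
      then show "?C (p + 0) c ({c} \<union> Y)" using Y by simp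
    qed (use True halves assms in auto)
    moreover have "{c} \<union> {c..<c + l} = {c..<c + l}" using assms by auto
    ultimately have "?C (2 * p) v {c..<c + l}" by simp
    then show ?thesis by (rule covers_mono) (simp add: Suc)
  next
    case False
    define d where "d = c + 2 ^ p"
    define A where "A = {c..<d}"
    define B where "B = {d..<c + l}"
    have AB: "{c..<c + l} = A \<union> B" "A \<inter> B = {}" "c \<in> A" "d \<in> B"
      using False by (auto simp: A_def B_def d_def)
    have B': "B = {d..<d + (l - 2 ^ p)}" using False by (auto simp: B_def d_def)
    have cA: "?C p c A"
      unfolding A_def d_def by (rule covers_binomial_root) (use halves in auto)
    have cB: "?C p d B"
      unfolding B' by (rule covers_binomial_root) (use halves False assms Suc in \<open>auto simp: d_def\<close>)
    have "?C (2 * p + 1) v {c..<c + l}"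
    proof (cases "v < d")
      case True
      have "?C (2 * p + 1) v (insert c B \<union> {c..<c + 2 ^ p})"
      proof (rule covers_binomial_delay)
        fix Y assume Y: "?C p c Y" "insert c B \<inter> Y = {c}"
        have "?C (Suc p) c (insert c B \<union> Y)"
          by (rule covers_call[OF _ Y(1) cB]) (use halves Y AB in \<open>auto simp: d_def\<close>)
        then show "?C (p + 1) c (insert c B \<union> Y)" by simp
      qed (use True halves assms AB in \<open>auto simp: A_def d_def\<close>)
      moreover have "insert c B \<union> {c..<c + 2 ^ p} = {c..<c + l}"
        using AB by (auto simp: A_def d_def)
      ultimately show ?thesis by simp
    next
      case False
      have "?C (2 * p + 1) v (insert d A \<union> {d..<d + (l - 2 ^ p)})"
      proof (rule covers_binomial_delay)
        fix Y assume Y: "?C p d Y" "insert d A \<inter> Y = {d}"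
        have "d \<notin> A" using AB by auto
        then have "A \<inter> Y = {}" using disjoint_of_insert_Int[OF Y(2)] by auto
        moreover have "d \<in> Y" using Y(1) by (rule covers_origin)
        ultimately have "?C (Suc p) d (insert d A \<union> Y)"
          by (intro covers_call[OF _ Y(1) cA]) (use halves in \<open>auto simp: d_def\<close>)
        then show "?C (p + 1) d (insert d A \<union> Y)" by simp
      next
        show "insert d A \<inter> {d..<d + (l - 2 ^ p)} = {d}"
          unfolding B'[symmetric] using AB by blast
      qed (use False halves assms Suc \<open>\<not> l \<le> 2 ^ p\<close> in \<open>auto simp: d_def\<close>)
      moreover have "insert d A \<union> {d..<d + (l - 2 ^ p)} = {c..<c + l}"
        unfolding B'[symmetric] using AB by blast
      ultimately show ?thesis by simp
    qed
    then show ?thesis using Suc by simp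
  qed
qed

text \<open>The hub calls the root of the half that does not contain the excluded block.\<close>

lemma covers_hub:
  fixes M d c :: nat
  assumes block: "\<And>c q. 2 ^ q dvd c \<Longrightarrow> c + 2 ^ q \<le> M \<Longrightarrow> covers E q c {c..<c + 2 ^ q}"
    and hub: "\<And>c. c < M \<Longrightarrow> {h, c} \<in> E"
    and X: "covers E m h X" "X \<inter> {..<M} = {}"
    and d: "2 ^ m dvd d"
  shows "m \<le> q \<Longrightarrow> 2 ^ q dvd c \<Longrightarrow> c + 2 ^ q \<le> M \<Longrightarrow> c \<le> d \<Longrightarrow> d < c + 2 ^ q \<Longrightarrow>
    covers E q h (X \<union> ({c..<c + 2 ^ q} - {d..<d + 2 ^ m}))"
proof (induction q arbitrary: c rule: dec_induct)
  case base
  have "2 ^ m dvd d - c" using d base.prems(1) by (rule dvd_diff_nat)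
  then have "d = c" using base.prems by (auto dest!: dvd_imp_le)
  then show ?case using X by simp
next
  case (step q)
  have dvd: "2 ^ q dvd c" "2 ^ q dvd c + 2 ^ q"
    using binomial_halves_edge[OF step.prems(1)] by auto
  let ?D = "{d..<d + 2 ^ m}"
  show ?case
  proof (cases "d < c + 2 ^ q")
    case True
    \<comment> \<open>Alignment keeps the excluded block from straddling the two halves.\<close>
    have "2 ^ m dvd c + 2 ^ q - d"
      using d dvd(2) step.hyps by (meson dvd_diff_nat dvd_trans le_imp_power_dvd)
    then have D: "d + 2 ^ m \<le> c + 2 ^ q" using True by (auto dest!: dvd_imp_le)
    have rec: "covers E q h (X \<union> ({c..<c + 2 ^ q} - ?D))"
      by (rule step.IH) (use step.prems dvd True in auto)
    have half: "covers E q (c + 2 ^ q) {c + 2 ^ q..<c + 2 ^ q + 2 ^ q}"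
      by (rule block) (use step.prems dvd in auto)
    have edge: "{h, c + 2 ^ q} \<in> E"
      by (rule hub) (use step.prems in \<open>auto intro: less_le_trans\<close>)
    show ?thesis
      by (rule covers_call[OF edge rec half]) (use X step.prems D in auto)
  next
    case False
    have rec: "covers E q h (X \<union> ({c + 2 ^ q..<c + 2 ^ q + 2 ^ q} - ?D))"
      by (rule step.IH) (use step.prems dvd False in auto)
    have half: "covers E q c {c..<c + 2 ^ q}"
      by (rule block) (use step.prems dvd in auto)
    have edge: "{h, c} \<in> E"
      by (rule hub) (use step.prems in \<open>auto intro: less_le_trans\<close>)
    show ?thesis
      by (rule covers_call[OF edge rec half]) (use X step.prems False in auto)
  qed
qed

section \<open>A hub joined to a tree\<close>

definition hub_graph :: "nat \<Rightarrow> (nat \<Rightarrow> nat) \<Rightarrow> nat \<Rightarrow> nat set set" where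
  "hub_graph h par n =
     (\<lambda>i. {i, par i}) ` ({1..<n} - {h}) \<union> (\<lambda>i. {i, h}) ` ({..<n} - {h})"

lemma sp_multigraph_hub_graph:
  assumes "0 < h" "1 \<le> n" and par: "\<And>i. 0 < i \<Longrightarrow> i < n \<Longrightarrow> par i < i \<and> par i \<noteq> h"
  shows "sp_multigraph (insert h {..<n}) (mset_set (hub_graph h par n))"
  using assms(2) par
proof (induction n rule: dec_induct)
  case base
  have "hub_graph h par 1 = {{0, h}}" using assms(1) by (auto simp: hub_graph_def)
  moreover have "insert h {..<1} = {0, h}" by auto
  ultimately show ?case using sp_multigraph.K2[of 0 h] assms(1) by simp
next
  case (step n)
  let ?E = "hub_graph h par n"
  have IH: "sp_multigraph (insert h {..<n}) (mset_set ?E)" using step by auto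
  show ?case
  proof (cases "n = h")
    case True
    have "{..<Suc n} - {h} = {..<n} - {h}" "{1..<Suc n} - {h} = {1..<n} - {h}"
      "insert h {..<Suc n} = insert h {..<n}" using True by auto
    then show ?thesis using IH by (simp add: hub_graph_def)
  next
    case False
    define p where "p = par n"
    have p: "p < n" "p \<noteq> h" using step unfolding p_def by auto
    have "{..<Suc n} - {h} = insert n ({..<n} - {h})" "{1..<Suc n} - {h} = insert n ({1..<n} - {h})"
      using False step.hyps by auto
    then have E: "hub_graph h par (Suc n) = insert {h, n} (insert {n, p} ?E)"
      by (auto simp: hub_graph_def p_def insert_commute)
    have fin: "finite ?E" by (simp add: hub_graph_def)
    \<comment> \<open>Doubling this spoke and subdividing the copy by \<open>n\<close> creates the
      new spoke and the new tree edge.\<close>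
    have "{h, p} \<in> ?E" using p by (auto simp: hub_graph_def)
    then have "sp_multigraph (insert h {..<n}) (add_mset {h, p} (mset_set ?E))"
      using IH fin by (intro sp_multigraph.parallel) auto
    then have "sp_multigraph (insert n (insert h {..<n}))
        (add_mset {h, p} (mset_set ?E) - {#{h, p}#} + {#{h, n}, {n, p}#})"
      by (rule sp_multigraph.series) (use False in auto)
    \<comment> \<open>Both new edges contain the fresh vertex \<open>n\<close>, so no edge becomes
      multiple.\<close>
    moreover have "e \<subseteq> insert h {..<n}" if "e \<in> ?E" for e
      using sp_multigraph_edge[OF IH] that fin by auto
    then have "{h, n} \<notin> insert {n, p} ?E" "{n, p} \<notin> ?E"
      using False p by (auto simp: doubleton_eq_iff)
    then have "mset_set (hub_graph h par (Suc n)) =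
        add_mset {h, p} (mset_set ?E) - {#{h, p}#} + {#{h, n}, {n, p}#}"
      unfolding E using fin by simp
    ultimately show ?thesis by (simp add: lessThan_Suc insert_commute)
  qed
qed

lemma hub_graph_hub_edge: "i < n \<Longrightarrow> i \<noteq> h \<Longrightarrow> {i, h} \<in> hub_graph h par n \<and> {h, i} \<in> hub_graph h par n"
  by (auto simp: hub_graph_def insert_commute)

lemma connected_hub_graph:
  assumes "h < n"
  shows "connected_graph {..<n} (hub_graph h par n)"
  unfolding connected_graph_def
proof (intro conjI ballI)
  show "{..<n} \<noteq> {}" using assms by auto
  let ?R = "{(x, y). {x, y} \<in> hub_graph h par n}"
  have R: "(u, h) \<in> ?R\<^sup>* \<and> (h, u) \<in> ?R\<^sup>*" if "u < n" for u
    using hub_graph_hub_edge[OF that, of h] by (cases "u = h") auto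
  fix u v assume "u \<in> {..<n}" "v \<in> {..<n}"
  then show "(u, v) \<in> ?R\<^sup>*" using R[of u] R[of v] by (auto intro: rtrancl_trans)
qed

section \<open>The parent function of the binomial tree\<close>

fun clear_low_bit :: "nat \<Rightarrow> nat" where
  "clear_low_bit i = (if i = 0 then 0 else if odd i then i - 1 else 2 * clear_low_bit (i div 2))"

declare clear_low_bit.simps [simp del]

lemma clear_low_bit_less: "0 < i \<Longrightarrow> clear_low_bit i < i"
proof (induction i rule: clear_low_bit.induct)
  case (1 i)
  show ?case
  proof (cases "odd i")
    case False
    then have "0 < i div 2" using 1 by (auto elim: evenE)
    then have "clear_low_bit (i div 2) < i div 2" using 1 False by auto
    then show ?thesis using False by (subst clear_low_bit.simps) auto
  qed (use 1 in \<open>auto simp: clear_low_bit.simps[of i]\<close>)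
qed

lemma clear_low_bit_add: "2 ^ Suc j dvd a \<Longrightarrow> clear_low_bit (a + 2 ^ j) = a"
proof (induction j arbitrary: a)
  case 0
  then show ?case by (subst clear_low_bit.simps) auto
next
  case (Suc j)
  then obtain b where b: "a = 2 * b" by (metis dvd_def power_Suc mult.assoc)
  have "2 ^ Suc j dvd b" using Suc.prems by (simp add: b)
  then have "clear_low_bit (b + 2 ^ j) = b" by (rule Suc.IH)
  then show ?case by (subst clear_low_bit.simps) (simp add: b)
qed

text \<open>The children of \<open>h\<close> in the infinite binomial tree are moved to \<open>0\<close>.\<close>

definition hub_parent :: "nat \<Rightarrow> nat \<Rightarrow> nat" where
  "hub_parent h i = (if clear_low_bit i = h then 0 else clear_low_bit i)"

text \<open>For \<open>a = h\<close> the first edge is a spoke and the second the redirected tree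
  edge. This is why the vertices beyond the hub form binomial subtrees under both \<open>h\<close>
  and 0.\<close>

lemma hub_graph_hub_parent_edge:
  assumes "2 ^ Suc j dvd a" "a + 2 ^ j < n" "a + 2 ^ j \<noteq> h"
  shows "{a, a + 2 ^ j} \<in> hub_graph h (hub_parent h) n"
    and "a = h \<Longrightarrow> {0, a + 2 ^ j} \<in> hub_graph h (hub_parent h) n"
proof -
  let ?i = "a + 2 ^ j"
  have i: "?i \<in> {1..<n} - {h}" using assms by (simp add: Suc_le_eq)
  then have "{?i, hub_parent h ?i} \<in> hub_graph h (hub_parent h) n"
    unfolding hub_graph_def by blast
  then have *: "{hub_parent h ?i, ?i} \<in> hub_graph h (hub_parent h) n"
    by (simp add: insert_commute)
  have par: "hub_parent h ?i = (if a = h then 0 else a)"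
    using clear_low_bit_add[OF assms(1)] by (simp add: hub_parent_def)
  show "{a, ?i} \<in> hub_graph h (hub_parent h) n"
    using * par hub_graph_hub_edge[of ?i n h] assms by (cases "a = h") auto
  show "{0, ?i} \<in> hub_graph h (hub_parent h) n" if "a = h" using * par that by simp
qed

section \<open>Broadcasting from every originator in \<open>k\<close> steps\<close>

lemma covers_hub_graph:
  assumes k: "1 \<le> k" and M: "M = 2 ^ (k - 1)"
    and n: "M < n" "n \<le> M + 2 ^ (k div 2)" and v: "v < n"
  shows "covers (hub_graph M (hub_parent M) n) k v {..<n}"
proof -
  define m where "m = k div 2"
  define l where "l = n - M"
  let ?E = "hub_graph M (hub_parent M) n"
  \<comment> \<open>After the first call \<open>k - 1\<close> steps remain; the exponent
    \<open>k div 2\<close> is chosen to make \<open>2 * m - 1\<close> fit.\<close>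
  have m: "m \<le> k - 1" "2 * m - 1 \<le> k - 1" using k by (auto simp: m_def)
  have l: "0 < l" "l \<le> 2 ^ m" "n = M + l" using n by (auto simp: l_def m_def)
  have bin_E: "{a, b} \<in> ?E" if "{a, b} \<in> binomial_edges" "a < M" "b < M" for a b
  proof -
    obtain x j where xj: "{a, b} = {x, x + 2 ^ j}" "2 ^ Suc j dvd x"
      using \<open>{a, b} \<in> binomial_edges\<close> unfolding binomial_edges_def by blast
    then have "x + 2 ^ j < M" using that by (auto simp: doubleton_eq_iff)
    then show ?thesis using hub_graph_hub_parent_edge(1)[OF xj(2), of n M] xj(1) n by auto
  qed
  have bin_M: "{M + a, M + b} \<in> ?E" "a \<noteq> 0 \<Longrightarrow> b = 0 \<Longrightarrow> {M + a, 0} \<in> ?E"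
    "b \<noteq> 0 \<Longrightarrow> a = 0 \<Longrightarrow> {0, M + b} \<in> ?E"
    if "{a, b} \<in> binomial_edges" "a < l" "b < l" for a b
  proof -
    obtain x j where xj: "{a, b} = {x, x + 2 ^ j}" "2 ^ Suc j dvd x"
      using \<open>{a, b} \<in> binomial_edges\<close> unfolding binomial_edges_def by blast
    have x: "x + 2 ^ j < l" using xj that by (auto simp: doubleton_eq_iff)
    then have "(2::nat) ^ j < 2 ^ m" using l by linarith
    then have "j < m" by simp
    \<comment> \<open>Only bits below \<open>m\<close> occur in numbers below \<open>l\<close>, and
      these bits are zero in \<open>M\<close>, so the shift by \<open>M\<close> preserves the tree
      edges.\<close>
    then have "2 ^ Suc j dvd M" unfolding M using m by (intro le_imp_power_dvd) auto
    then have dvd: "2 ^ Suc j dvd M + x" using xj by simp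
    have "M + x + 2 ^ j < n" "M + x + 2 ^ j \<noteq> M" using x l by auto
    note e = hub_graph_hub_parent_edge[OF dvd this]
    have ab: "a = x \<and> b = x + 2 ^ j \<or> a = x + 2 ^ j \<and> b = x"
      using xj(1) by (auto simp: doubleton_eq_iff)
    show "{M + a, M + b} \<in> ?E" using ab e(1) by (auto simp: add.assoc insert_commute)
    show "{M + a, 0} \<in> ?E" if "a \<noteq> 0" "b = 0"
      using ab e(2) that by (auto simp: insert_commute)
    show "{0, M + b} \<in> ?E" if "b \<noteq> 0" "a = 0"
      using ab e(2) that by auto
  qed
  have main: "covers ?E t u S" if "covers binomial_edges t u S" "S \<subseteq> {..<M}" for t u S
    using covers_image[OF that(1), of id ?E] bin_E that(2) by (auto simp: subset_iff)
  have block: "covers ?E q c {c..<c + 2 ^ q}" if "2 ^ q dvd c" "c + 2 ^ q \<le> M" for c q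
    by (rule main[OF covers_binomial_root]) (use that in auto)
  have hub: "{M, c} \<in> ?E" if "c < M" for c
    using hub_graph_hub_edge[of c n M] that n by auto
  have extra: "covers ?E m M {M..<n}"
    using covers_image[OF covers_binomial_root[of m 0 l], of "(+) M" ?E] bin_M(1) l
    by (auto simp: add.commute)
  have rest: "covers ?E (k - 1) M ({M..<n} \<union> ({0..<M} - {d..<d + 2 ^ m}))"
    if "2 ^ m dvd d" "d < M" for d
  proof -
    have "{M..<n} \<inter> {..<M} = {}" by auto
    then show ?thesis
      using covers_hub[of M ?E M m "{M..<n}" d "k - 1" 0] block hub extra that m M by simp
  qed
  have DM: "d + 2 ^ m \<le> M" if "2 ^ m dvd d" "d < M" for d
  proof -
    have "2 ^ m dvd M - d" using that m M by (simp add: dvd_diff_nat le_imp_power_dvd)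
    then show ?thesis using that by (auto dest!: dvd_imp_le)
  qed
  have own: "covers ?E (k - 1) u {d..<d + 2 ^ m}"
    if "2 ^ m dvd d" "d \<le> u" "u < d + 2 ^ m" "d < M" for u d
  proof -
    have "covers ?E (2 * m - 1) u {d..<d + 2 ^ m}"
      using that DM[of d] by (intro main covers_binomial) auto
    then show ?thesis using m(2) by (rule covers_mono)
  qed
  have M0: "0 < M" by (simp add: M)
  have Sk: "k = Suc (k - 1)" using k by simp
  consider "v < M" | "v = M" | "M < v" by linarith
  then show ?thesis
  proof cases
    case 1
    \<comment> \<open>The start of the aligned block of length \<open>2 ^ m\<close> containing
      \<open>v\<close>.\<close>
    define d where "d = v - v mod 2 ^ m"
    have d: "2 ^ m dvd d" "d \<le> v" "v < d + 2 ^ m" "d < M"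
      using 1 mod_less_divisor[of "2 ^ m" v] unfolding d_def
      by (auto simp: dvd_minus_mod less_diff_conv2 simp del: mod_less_divisor)
    show ?thesis
      by (subst Sk, rule covers_call[of v M, OF _ own rest])
        (use d DM[of d] 1 n hub_graph_hub_edge[of v n M] in auto)
  next
    case 2
    show ?thesis
      by (subst Sk, rule covers_call[of v 0, OF _ _ own[of 0]])
        (use 2 rest[of 0] DM[of 0] M0 n hub in auto)
  next
    case 3
    \<comment> \<open>Replaces the root \<open>M\<close> of the extra tree by 0, so that
      \<open>v\<close> can serve it without the hub.\<close>
    define f where "f i = (if i = 0 then 0 else M + i)" for i
    have inj: "inj_on f {0..<0 + l}" by (auto simp: f_def inj_on_def M0)
    have fl: "f ` {0..<0 + l} = insert 0 {Suc M..<n}"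
    proof -
      have "f ` {0..<0 + l} = f ` insert 0 {1..<l}" using l by (intro arg_cong[of _ _ "image f"]) auto
      also have "\<dots> = insert 0 ((+) M ` {1..<l})"
        unfolding image_insert by (intro arg_cong2[of _ _ _ _ insert] image_cong) (auto simp: f_def)
      also have "(+) M ` {1..<l} = {Suc M..<n}" using l by (simp add: add.commute)
      finally show ?thesis .
    qed
    have "covers ?E (2 * m - 1) (f (v - M)) (f ` {0..<0 + l})"
      by (rule covers_image[OF covers_binomial inj])
        (use 3 v l bin_M in \<open>auto simp: f_def insert_commute singleton_notin_binomial_edges\<close>)
    moreover have "f (v - M) = v" using 3 by (simp add: f_def)
    ultimately have v0: "covers ?E (k - 1) v (insert 0 {Suc M..<n})"
      unfolding fl using m(2) covers_mono by metis
    \<comment> \<open>Vertex 0 lies in the territory of \<open>v\<close>, so the hub leaves out a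
      block of order 0.\<close>
    have M1: "covers ?E (k - 1) M ({M} \<union> ({0..<M} - {0}))"
      using covers_hub[of M ?E M 0 "{M}" 0 "k - 1" 0] block hub M M0 by simp
    show ?thesis
      by (subst Sk, rule covers_call[OF _ v0 M1]) (use 3 v M0 n hub_graph_hub_edge[of v n M] in auto)
  qed
qed

theorem theorem6:
  fixes k n :: nat
  assumes "k \<ge> 1"
    and "2 ^ (k - 1) + 1 \<le> n"
    and "n \<le> 2 ^ (k - 1) + 2 ^ (k div 2)"
  shows "\<exists>(V :: nat set) (E :: nat set set).
           card V = n \<and> sp_graph V E \<and> broadcast_graph V E"
proof -
  define M :: nat where "M = 2 ^ (k - 1)"
  define V where "V = {..<n}"
  define E where "E = hub_graph M (hub_parent M) n"
  have M: "0 < M" "M < n" using assms by (auto simp: M_def)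
  have "sp_multigraph (insert M {..<n}) (mset_set E)"
    unfolding E_def
  proof (rule sp_multigraph_hub_graph)
    fix i :: nat assume "0 < i"
    then show "hub_parent M i < i \<and> hub_parent M i \<noteq> M"
      using clear_low_bit_less[of i] M by (auto simp: hub_parent_def)
  qed (use M in auto)
  moreover have "insert M {..<n} = V" using M by (auto simp: V_def)
  ultimately have sp: "sp_multigraph V (mset_set E)" by simp
  have "finite E" by (simp add: E_def hub_graph_def)
  then have simple: "simple_graph V E"
    using sp_multigraph_edge[OF sp] by (auto simp: simple_graph_def V_def)
  have time: "broadcast_time_from V E v = k" if v: "v \<in> V" for v
    unfolding broadcast_time_from_def
  proof (rule Least_equality)
    have "covers E k v V"
      using covers_hub_graph[of k M n v] assms M M_def v by (auto simp: V_def E_def)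
    then show "(broadcast_step V E ^^ k) {v} V"
      by (intro relpow_broadcast_step_covers[where S = "\<lambda>_. V"]) auto
  next
    \<comment> \<open>Doubling excludes fewer than \<open>k\<close> steps because \<open>n\<close>
      exceeds \<open>2 ^ (k - 1)\<close>.\<close>
    fix t assume "(broadcast_step V E ^^ t) {v} V"
    then have "n \<le> 2 ^ t"
      using relpow_broadcast_step_card[of t V E "{v}" V] by (simp add: V_def)
    then have "(2::nat) ^ (k - 1) < 2 ^ t" using assms by linarith
    then have "k - 1 < t" by simp
    then show "k \<le> t" by simp
  qed
  have "V \<noteq> {}" using M by (auto simp: V_def)
  then have "broadcast_time_from V E ` V = {k}" using time by auto
  then have "broadcast_time V E = k" by (simp add: broadcast_time_def)
  moreover have "\<lceil>log 2 (real n)\<rceil> = int k"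
  proof -
    have "(2::nat) ^ (k div 2) \<le> 2 ^ (k - 1)" using assms(1) by (intro power_increasing) auto
    moreover have "(2::nat) ^ k = 2 ^ (k - 1) + 2 ^ (k - 1)"
      using assms(1) by (cases k) auto
    ultimately have "n \<le> 2 ^ k" using assms(3) by linarith
    then show ?thesis
      using ceiling_log_nat_eq_if[of 2 "k - 1" n] assms by simp
  qed
  ultimately have "broadcast_graph V E"
    using simple connected_hub_graph[OF M(2), of "hub_parent M"]
    by (simp add: broadcast_graph_def V_def E_def)
  then show ?thesis using simple sp by (intro exI[of _ V] exI[of _ E]) (auto simp: sp_graph_def V_def)
qed

end
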